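(* Let $\mathcal{E}=(V,\mu)$ be an evolution algebra over an arbitrary field $\mathbb{K}$ with natural basis $B=\{e_1,\dots,e_n\}$, and let $\nu_t=\mu+\sum_{k\ge 1}\nu_k t^k$ and $\lambda_t=\mu+\sum_{k\ge 1}\lambda_k t^k$ be two deformations of $\mathcal{E}$. If $\nu_t$ and $\lambda_t$ are equivalent, then there exists a linear map $\varphi\in\operatorname{End}_{\mathbb{K}}(V)$ such that, for all $u,v\in V$, $$\lambda_1(u,v)-\nu_1(u,v)=\varphi(uv)-u\,\varphi(v)-\varphi(u)\,v,$$ where juxtaposition denotes the product $\mu$.
   Context: An evolution algebra over a field $\mathbb{K}$ is a pair $\mathcal{E}=(V,\mu)$, where $V$ is a finite-dimensional $\mathbb{K}$-vector space and $\mu\colon V\times V\to V$ is a bilinear map admitting a basis $B=\{e_1,\dots,e_n\}$ of $V$ (a natural basis) with $\mu(e_i,e_j)=0$ for all $i\neq j$. A natural basis $B$ is fixed. One writes $uv=\mu(u,v)$. Let $V[[t]]$ be the $\mathbb{K}[[t]]$-module of formal power series with coefficients in $V$. $\mathbb{K}$-bilinear (resp. linear) maps on $V$ are extended $\mathbb{K}[[t]]$-bilinearly (resp. linearly) to $V[[t]]$. A deformation (formal evolution deformation) of $\mathcal{E}$ is a $\mathbb{K}[[t]]$-bilinear map $\nu_t\colon V[[t]]\times V[[t]]\to V[[t]]$ of the form $\nu_t=\mu+\sum_{k\ge1}\nu_k t^k$, with each $\nu_k\colon V\times V\to V$ a $\mathbb{K}$-bilinear map, such that $\nu_t(e_i,e_j)=0$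 for all $i\ne j$. Two deformations $\nu_t,\lambda_t$ of $\mathcal{E}$ are equivalent if there is a $\mathbb{K}[[t]]$-linear map $\phi_t\colon V[[t]]\to V[[t]]$ of the form $\phi_t=\operatorname{Id}+t\phi_1+t^2\phi_2+\cdots$, with each $\phi_k\colon V\to V$ $\mathbb{K}$-linear, such that $\phi_t(\nu_t(u,v))=\lambda_t(\phi_t(u),\phi_t(v))$ for all $u,v\in V$. *)

theory Defs
  imports "HOL-Computational_Algebra.Formal_Power_Series"
begin

definition module_bilinear ::
  "('r::comm_ring_1 \<Rightarrow> 'm::ab_group_add \<Rightarrow> 'm) \<Rightarrow> ('m \<Rightarrow> 'm \<Rightarrow> 'm) \<Rightarrow> bool"
  where "module_bilinear s b \<longleftrightarrow>
    (\<forall>x. module_hom s s (b x)) \<and> (\<forall>y. module_hom s s (\<lambda>x. b x y))"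

locale evolution_algebra = finite_dimensional_vector_space scale B
  for scale :: "'k::field \<Rightarrow> 'v::ab_group_add \<Rightarrow> 'v" and B :: "'v set" +
  fixes \<mu> :: "'v \<Rightarrow> 'v \<Rightarrow> 'v"
  assumes mult_bilinear: "module_bilinear scale \<mu>"
    and mult_natural: "\<And>e f. e \<in> B \<Longrightarrow> f \<in> B \<Longrightarrow> e \<noteq> f \<Longrightarrow> \<mu> e f = 0"

text \<open>
  The module \<open>V[[t]]\<close> is the additive group \<open>'v fps\<close> with the following action of
  \<open>K[[t]]\<close>, and \<open>V\<close> sits inside it via \<^const>\<open>fps_const\<close>.
\<close>

definition fps_scale ::
  "('k::field \<Rightarrow> 'v::ab_group_add \<Rightarrow> 'v) \<Rightarrow> 'k fps \<Rightarrow> 'v fps \<Rightarrow> 'v fps"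
  where "fps_scale scale a x =
    Abs_fps (\<lambda>n. \<Sum>i\<le>n. scale (fps_nth a i) (fps_nth x (n - i)))"

text \<open>The \<open>K[[t]]\<close>-linear and \<open>K[[t]]\<close>-bilinear extensions to \<open>V[[t]]\<close> of maps on \<open>V\<close>
  (see \<open>module_hom_ext_linear\<close> and \<open>module_bilinear_ext_bilinear\<close> below).\<close>

definition ext_linear :: "('v::ab_group_add \<Rightarrow> 'v) \<Rightarrow> 'v fps \<Rightarrow> 'v fps"
  where "ext_linear f x = Abs_fps (\<lambda>n. f (fps_nth x n))"

definition ext_bilinear ::
  "('v::ab_group_add \<Rightarrow> 'v \<Rightarrow> 'v) \<Rightarrow> 'v fps \<Rightarrow> 'v fps \<Rightarrow> 'v fps"
  where "ext_bilinear b x y =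
    Abs_fps (\<lambda>n. \<Sum>i\<le>n. b (fps_nth x i) (fps_nth y (n - i)))"

text \<open>The \<open>t\<close>-adically convergent sum \<open>\<Sum>k. t^k F\<^sub>k\<close> of a sequence \<open>F\<close> in \<open>V[[t]]\<close>.\<close>

definition t_series :: "(nat \<Rightarrow> 'v::ab_group_add fps) \<Rightarrow> 'v fps"
  where "t_series F = Abs_fps (\<lambda>n. \<Sum>k\<le>n. fps_nth (F k) (n - k))"

text \<open>The coefficient maps \<open>\<nu> k\<close> are carried along explicitly so that \<open>\<nu> 1\<close> can be named;
  they are determined by \<open>\<nu>_t\<close>.\<close>

definition deformation ::
  "('k::field \<Rightarrow> 'v::ab_group_add \<Rightarrow> 'v) \<Rightarrow> 'v set \<Rightarrow> ('v \<Rightarrow> 'v \<Rightarrow> 'v) \<Rightarrow>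
   ('v fps \<Rightarrow> 'v fps \<Rightarrow> 'v fps) \<Rightarrow> (nat \<Rightarrow> 'v \<Rightarrow> 'v \<Rightarrow> 'v) \<Rightarrow> bool"
  where "deformation scale B \<mu> \<nu>_t \<nu> \<longleftrightarrow>
    module_bilinear (fps_scale scale) \<nu>_t \<and>
    \<nu> 0 = \<mu> \<and> (\<forall>k\<ge>1. module_bilinear scale (\<nu> k)) \<and>
    (\<forall>x y. \<nu>_t x y = t_series (\<lambda>k. ext_bilinear (\<nu> k) x y)) \<and>
    (\<forall>e\<in>B. \<forall>f\<in>B. e \<noteq> f \<longrightarrow> \<nu>_t (fps_const e) (fps_const f) = 0)"

definition equivalent_deformations ::
  "('k::field \<Rightarrow> 'v::ab_group_add \<Rightarrow> 'v) \<Rightarrow>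
   ('v fps \<Rightarrow> 'v fps \<Rightarrow> 'v fps) \<Rightarrow> ('v fps \<Rightarrow> 'v fps \<Rightarrow> 'v fps) \<Rightarrow> bool"
  where "equivalent_deformations scale \<nu>_t lam_t \<longleftrightarrow>
    (\<exists>\<phi>_t \<phi>. module_hom (fps_scale scale) (fps_scale scale) \<phi>_t \<and>
      \<phi> 0 = id \<and> (\<forall>k\<ge>1. Vector_Spaces.linear scale scale (\<phi> k)) \<and>
      (\<forall>x. \<phi>_t x = t_series (\<lambda>k. ext_linear (\<phi> k) x)) \<and>
      (\<forall>u v. \<phi>_t (\<nu>_t (fps_const u) (fps_const v)) =
             lam_t (\<phi>_t (fps_const u)) (\<phi>_t (fps_const v))))"

lemma ext_linear_const: "f 0 = 0 \<Longrightarrow> ext_linear f (fps_const v) = fps_const (f v)"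
  by (rule fps_ext) (simp add: ext_linear_def)

lemma ext_bilinear_const:
  assumes "\<And>v. b 0 v = 0" "\<And>v. b v 0 = 0"
  shows "ext_bilinear b (fps_const u) (fps_const v) = fps_const (b u v)"
proof (rule fps_ext)
  fix n
  have "(\<Sum>i\<le>n. b (fps_nth (fps_const u) i) (fps_nth (fps_const v) (n - i))) =
        (\<Sum>i\<le>n. if i = 0 then b u (fps_nth (fps_const v) n) else 0)"
    by (rule sum.cong) (auto simp: assms)
  then show "fps_nth (ext_bilinear b (fps_const u) (fps_const v)) n = fps_nth (fps_const (b u v)) n"
    by (simp add: ext_bilinear_def assms)
qed

lemma triple_sum_assoc:
  fixes f :: "nat \<Rightarrow> nat \<Rightarrow> nat \<Rightarrow> 'a::comm_monoid_add"
  shows "(\<Sum>k\<le>n. \<Sum>i\<le>k. f i (k - i) (n - k)) = (\<Sum>i\<le>n. \<Sum>j\<le>n - i. f i j (n - i - j))"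
proof -
  have "(\<Sum>k\<le>n. \<Sum>i\<le>k. f i (k - i) (n - k)) =
        (\<Sum>i\<le>n. \<Sum>j\<le>n - i. f i j (n - (i + j)))"
    using sum.triangle_reindex_eq[of "\<lambda>i j. f i j (n - (i + j))" n]
    by (simp add: sum.Sigma lessThan_Suc_atMost)
       (auto intro!: sum.reindex_bij_witness[of _ "\<lambda>(i, j). (i + j, i)" "\<lambda>(k, i). (i, k - i)"])
  then show ?thesis by simp
qed

context vector_space
begin

lemma module_fps_scale: "module (fps_scale scale)"
proof
  fix a b :: "'a fps" and x y :: "'b fps"
  show "fps_scale scale a (x + y) = fps_scale scale a x + fps_scale scale a y"
    by (rule fps_ext) (simp add: fps_scale_def scale_right_distrib sum.distrib)
  show "fps_scale scale (a + b) x = fps_scale scale a x + fps_scale scale b x"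
    by (rule fps_ext) (simp add: fps_scale_def scale_left_distrib sum.distrib)
  show "fps_scale scale a (fps_scale scale b x) = fps_scale scale (a * b) x"
  proof (rule fps_ext)
    fix n
    show "fps_nth (fps_scale scale a (fps_scale scale b x)) n = fps_nth (fps_scale scale (a * b) x) n"
      using triple_sum_assoc[of "\<lambda>i j k. scale (fps_nth a i * fps_nth b j) (fps_nth x k)" n]
      by (simp add: fps_scale_def fps_mult_nth scale_sum_right scale_sum_left atLeast0AtMost)
  qed
  show "fps_scale scale 1 x = x"
  proof (rule fps_ext)
    fix n
    have "(\<Sum>i\<le>n. scale (fps_nth 1 i) (fps_nth x (n - i))) =
          (\<Sum>i\<le>n. if i = 0 then fps_nth x n else 0)"
      by (rule sum.cong) auto
    then show "fps_nth (fps_scale scale 1 x) n = fps_nth x n"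
      by (simp add: fps_scale_def)
  qed
qed

lemma module_hom_ext_linear:
  assumes "Vector_Spaces.linear scale scale f"
  shows "module_hom (fps_scale scale) (fps_scale scale) (ext_linear f)"
proof -
  interpret f: Vector_Spaces.linear scale scale f by fact
  interpret m: module "fps_scale scale" by (rule module_fps_scale)
  show ?thesis
    by unfold_locales (auto intro!: fps_ext simp: ext_linear_def fps_scale_def f.add f.scale f.sum)
qed

lemma module_bilinear_ext_bilinear:
  assumes "module_bilinear scale b"
  shows "module_bilinear (fps_scale scale) (ext_bilinear b)"
proof -
  interpret m: module "fps_scale scale" by (rule module_fps_scale)
  have r: "module_hom scale scale (b x)" and l: "module_hom scale scale (\<lambda>x. b x y)" for x y
    using assms by (auto simp: module_bilinear_def)
  note r' = module_hom.add[OF r] module_hom.scale[OF r] module_hom.sum[OF r]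
  note l' = module_hom.add[OF l] module_hom.scale[OF l] module_hom.sum[OF l]
  have sl: "ext_bilinear b (fps_scale scale a x) y = fps_scale scale a (ext_bilinear b x y)" for a x y
  proof (rule fps_ext)
    fix n
    show "fps_nth (ext_bilinear b (fps_scale scale a x) y) n =
          fps_nth (fps_scale scale a (ext_bilinear b x y)) n"
      using triple_sum_assoc[of "\<lambda>i j k. scale (fps_nth a i) (b (fps_nth x j) (fps_nth y k))" n]
      by (simp add: ext_bilinear_def fps_scale_def l' scale_sum_right)
  qed
  have flip: "ext_bilinear b x y = ext_bilinear (\<lambda>x y. b y x) y x" for x y and b :: "'b \<Rightarrow> 'b \<Rightarrow> 'b"
  proof (rule fps_ext)
    fix n
    show "fps_nth (ext_bilinear b x y) n = fps_nth (ext_bilinear (\<lambda>x y. b y x) y x) n"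
      unfolding ext_bilinear_def fps_nth_Abs_fps
      by (rule sum.reindex_bij_witness[of _ "\<lambda>i. n - i" "\<lambda>i. n - i"]) auto
  qed
  have sr: "ext_bilinear b x (fps_scale scale a y) = fps_scale scale a (ext_bilinear b x y)" for a x y
  proof (rule fps_ext)
    fix n
    show "fps_nth (ext_bilinear b x (fps_scale scale a y)) n =
          fps_nth (fps_scale scale a (ext_bilinear b x y)) n"
      using triple_sum_assoc[of "\<lambda>i j k. scale (fps_nth a i) (b (fps_nth x k) (fps_nth y j))" n]
      unfolding flip[of b]
      by (simp add: ext_bilinear_def fps_scale_def r' scale_sum_right)
  qed
  show ?thesis
    unfolding module_bilinear_def
    by (intro allI conjI; unfold_locales)
       (auto intro!: fps_ext simp: sl sr, auto simp: ext_bilinear_def r' l' sum.distrib)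
qed

end

end

theory Submission
  imports Defs
begin

text \<open>
  Comparing the coefficients of \<open>t\<close> on both sides of
  \<open>\<phi>_t (\<nu>_t u v) = \<lambda>_t (\<phi>_t u) (\<phi>_t v)\<close> for constant \<open>u\<close>, \<open>v\<close> gives
  \<open>\<nu>\<^sub>1(u,v) + \<phi>\<^sub>1(uv) = \<lambda>\<^sub>1(u,v) + u \<phi>\<^sub>1(v) + \<phi>\<^sub>1(u) v\<close>, so \<open>\<phi>\<^sub>1\<close> is the required map.
\<close>

text \<open>Only the splittings 1 = 0 + 1 = 1 + 0 between the order of the map and the degree in
  \<open>x\<close> contribute. The index is \<open>Suc 0\<close>, the normal form of 1 under
  simplification, so that the equation can rewrite.\<close>

lemma fps_nth_1_t_series_ext_linear:
  "fps_nth (t_series (\<lambda>k. ext_linear (f k) x)) (Suc 0)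
    = f 0 (fps_nth x 1) + f 1 (fps_nth x 0)"
  by (simp add: t_series_def ext_linear_def)

text \<open>One summand for each way to place the single factor t: in \<open>y\<close>, in
  \<open>x\<close> or in the order of the map.\<close>

lemma fps_nth_1_t_series_ext_bilinear:
  "fps_nth (t_series (\<lambda>k. ext_bilinear (b k) x y)) (Suc 0)
    = b 0 (fps_nth x 0) (fps_nth y 1) + b 0 (fps_nth x 1) (fps_nth y 0)
      + b 1 (fps_nth x 0) (fps_nth y 0)"
  by (simp add: t_series_def ext_bilinear_def)

lemma fps_nth_0_t_series_ext_linear:
  "fps_nth (t_series (\<lambda>k. ext_linear (f k) x)) 0 = f 0 (fps_nth x 0)"
  by (simp add: t_series_def ext_linear_def)

lemma fps_nth_0_t_series_ext_bilinear:
  "fps_nth (t_series (\<lambda>k. ext_bilinear (b k) x y)) 0 = b 0 (fps_nth x 0) (fps_nth y 0)"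
  by (simp add: t_series_def ext_bilinear_def)

lemma module_bilinear_zero:
  assumes "module_bilinear s b"
  shows "b x 0 = 0" "b 0 y = 0"
proof -
  have "module_hom s s (b x)" "module_hom s s (\<lambda>x. b x y)"
    using assms by (simp_all add: module_bilinear_def)
  from this[THEN module_hom.zero] show "b x 0 = 0" "b 0 y = 0" .
qed

theorem theorem3p9:
  fixes scale :: "'k::field \<Rightarrow> 'v::ab_group_add \<Rightarrow> 'v"
    and B :: "'v set"
    and \<mu> :: "'v \<Rightarrow> 'v \<Rightarrow> 'v"
    and \<nu>_t lam_t :: "'v fps \<Rightarrow> 'v fps \<Rightarrow> 'v fps"
    and \<nu> lam :: "nat \<Rightarrow> 'v \<Rightarrow> 'v \<Rightarrow> 'v"
  assumes "evolution_algebra scale B \<mu>"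
    and "deformation scale B \<mu> \<nu>_t \<nu>"
    and "deformation scale B \<mu> lam_t lam"
    and "equivalent_deformations scale \<nu>_t lam_t"
  shows "\<exists>\<phi>. Vector_Spaces.linear scale scale \<phi> \<and>
    (\<forall>u v. lam 1 u v - \<nu> 1 u v = \<phi> (\<mu> u v) - \<mu> u (\<phi> v) - \<mu> (\<phi> u) v)"
proof -
  \<comment> \<open>A constant series has coefficient 0 at t, so its cross terms under
    \<open>\<mu>\<close> have a zero argument and vanish.\<close>
  have \<mu>: "\<mu> x 0 = 0" "\<mu> 0 y = 0" for x y
    using module_bilinear_zero[OF evolution_algebra.mult_bilinear[OF assms(1)]] by auto
  have \<nu>: "\<nu> 0 = \<mu>" "\<nu>_t x y = t_series (\<lambda>k. ext_bilinear (\<nu> k) x y)" for x y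
    using assms(2) by (simp_all add: deformation_def)
  have lam: "lam 0 = \<mu>" "lam_t x y = t_series (\<lambda>k. ext_bilinear (lam k) x y)" for x y
    using assms(3) by (simp_all add: deformation_def)
  obtain \<phi>_t \<phi> where \<phi>: "\<phi> 0 = id" "Vector_Spaces.linear scale scale (\<phi> 1)"
      "\<And>x. \<phi>_t x = t_series (\<lambda>k. ext_linear (\<phi> k) x)"
    and equiv: "\<And>u v. \<phi>_t (\<nu>_t (fps_const u) (fps_const v))
        = lam_t (\<phi>_t (fps_const u)) (\<phi>_t (fps_const v))"
    using assms(4) unfolding equivalent_deformations_def by (metis order_refl)
  \<comment> \<open>On the left, \<open>\<phi> 1\<close> meets the constant term
    \<open>\<mu> u v\<close> of the product. On the right, \<open>\<phi>_t\<close> sends the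
    constant u to a series with constant term u and t-coefficient \<open>\<phi> 1 u\<close>, because
    \<open>\<phi> 0 = id\<close>.\<close>
  have "\<nu> 1 u v + \<phi> 1 (\<mu> u v) = \<mu> u (\<phi> 1 v) + \<mu> (\<phi> 1 u) v + lam 1 u v" for u v
    using arg_cong[OF equiv[of u v], of "\<lambda>x. fps_nth x 1"]
    by (simp add: \<nu> lam \<phi>(1,3) \<mu> fps_nth_0_t_series_ext_linear fps_nth_0_t_series_ext_bilinear
        fps_nth_1_t_series_ext_linear fps_nth_1_t_series_ext_bilinear)
  then have "lam 1 u v - \<nu> 1 u v = \<phi> 1 (\<mu> u v) - \<mu> u (\<phi> 1 v) - \<mu> (\<phi> 1 u) v" for u v
    by (simp add: algebra_simps)
  with \<phi>(2) show ?thesis by blast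
qed

end
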